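(* Let $z:\mathcal P(I)\to\hat{\mathbb R}$ be a submodular function on a finite set $I$ and $P$ a preorder on $I$. The face $\Phi_z(P)$ of $\Pi(z)$ is non-empty if and only if $P$ is compatible with $z$. In this case $\Phi_z(P)=\Pi(z_P)$. If $P$ conforms to $z$, the dimension of this face is $|I|-|\mathbf b(P)|$.
   Context: $\hat{\mathbb R}=\mathbb R\cup\{\infty\}$. A function $z:\mathcal P(I)\to\hat{\mathbb R}$ with $z(\emptyset)=0$, $z(I)<\infty$ is submodular if $z(A\cup B)+z(A\cap B)\le z(A)+z(B)$ for all $A,B\subseteq I$. For $A\subseteq B\subseteq I$ with $z(A),z(B)<\infty$, $z_{B/A}(U)=z(A\cup U)-z(A)$ for $U\subseteq B\setminus A$. Product of functions on disjoint sets: $(u\cdot v)(E)=u(E\cap S)+v(E\cap T)$ for $E\subseteq S\sqcup T$. $z'$ on $\mathcal P(C)$ decomposes along $C=C_1\sqcup C_2$ if $z'(E)=z'(E\cap C_1)+z'(E\cap C_2)$ for all $E\subseteq C$. A preorder is a reflexive transitive relation; $\mathbf b(P)$ is the set of bubbles of $P$, i.e. classes of $x\sim y\Leftrightarrow x\le_Py\le_Px$; down-sets contain everything below their elements; convex subsets are $C=B\setminus A$ with $A\subseteq B$ down-sets; $C=C_1\sqcup C_2$ is a disconnected union if no element of $C_1$ is comparable to one of $C_2$. $P$ is compatible with $z$ if $z(A)<\infty$ for all down-sets $A$, and for down-sets $A\subseteq B$ with $B\setminus A=C_1\sqcup C_2$ a disconnected union, $z_{B/A}$ decomposes along $C_1\sqcup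 C_2$; then $z_{B/A}$ depends only on $C=B\setminus A$ and is written $z_C$. $P$ conforms to $z$ if moreover, for convex $C$, a decomposition of $z_C$ along $C=C_1\sqcup C_2$ implies that $C=C_1\sqcup C_2$ is a disconnected union in $P$. For $P$ compatible with $z$, $z_P=\prod_{C\in\mathbf b(P)}z_C$, a submodular function on $I$. For $x\in\mathbb RI$ (real vector space with basis $I$), $x_A=\sum_{i\in A}x_i$. $\Pi(z)=\{x\in\mathbb RI:x_I=z(I),\ x_A\le z(A)\text{ whenever }z(A)<\infty\}$. $\Phi_z(P)=\{x\in\Pi(z):x_A=z(A)\text{ for every down-set }A\text{ of }P\}$ (a possibly empty face). *)

theory Defs
  imports "HOL-Analysis.Analysis"
begin

text \<open>
  The ground set \<open>I\<close> is a subset of a finite type \<open>'i\<close>, so that \<open>I = {}\<close> is allowed.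
  The space \<open>\<real>I\<close> is the coordinate subspace of \<open>real ^ 'i\<close> of vectors supported on \<open>I\<close>.
  Set functions on \<open>I\<close> are functions on \<open>'i set\<close> of which only the values on subsets of \<open>I\<close> matter.
\<close>

text \<open>
  The value domain is the real line extended by \<open>\<infinity>\<close> only, whereas \<^typ>\<open>ereal\<close> also has \<open>-\<infinity>\<close>;
  the first conjunct excludes that value.
\<close>
definition submodular_fun :: "'i set \<Rightarrow> ('i set \<Rightarrow> ereal) \<Rightarrow> bool" where
  "submodular_fun I z \<longleftrightarrow>
     (\<forall>A\<subseteq>I. z A \<noteq> -\<infinity>) \<and> z {} = 0 \<and> z I < \<infinity> \<and>
     (\<forall>A\<subseteq>I. \<forall>B\<subseteq>I. z (A \<union> B) + z (A \<inter> B) \<le> z A + z B)"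

text \<open>
  This is \<open>z\<^bsub>B/A\<^esub>\<close>. The set \<open>B\<close> only serves to restrict the domain to subsets of \<open>B - A\<close>,
  so it is not an argument.
\<close>
definition minor_fun :: "('i set \<Rightarrow> ereal) \<Rightarrow> 'i set \<Rightarrow> 'i set \<Rightarrow> ereal" where
  "minor_fun z A U = z (A \<union> U) - z A"

definition decomposes_along :: "('i set \<Rightarrow> ereal) \<Rightarrow> 'i set \<Rightarrow> 'i set \<Rightarrow> bool" where
  "decomposes_along f C1 C2 \<longleftrightarrow> (\<forall>E\<subseteq>C1 \<union> C2. f E = f (E \<inter> C1) + f (E \<inter> C2))"

text \<open>A pair \<open>(x, y)\<close> in the preorder \<open>P\<close> means \<open>x \<le>\<^sub>P y\<close>.\<close>

definition bubbles :: "'i set \<Rightarrow> 'i rel \<Rightarrow> 'i set set" where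
  "bubbles I P = I // (P \<inter> P\<inverse>)"

definition down_set :: "'i set \<Rightarrow> 'i rel \<Rightarrow> 'i set \<Rightarrow> bool" where
  "down_set I P A \<longleftrightarrow> A \<subseteq> I \<and> (\<forall>x y. y \<in> A \<longrightarrow> (x, y) \<in> P \<longrightarrow> x \<in> A)"

definition convex_subset :: "'i set \<Rightarrow> 'i rel \<Rightarrow> 'i set \<Rightarrow> bool" where
  "convex_subset I P C \<longleftrightarrow>
     (\<exists>A B. down_set I P A \<and> down_set I P B \<and> A \<subseteq> B \<and> C = B - A)"

definition disconnected_union :: "'i rel \<Rightarrow> 'i set \<Rightarrow> 'i set \<Rightarrow> 'i set \<Rightarrow> bool" where
  "disconnected_union P C C1 C2 \<longleftrightarrow>
     C = C1 \<union> C2 \<and> C1 \<inter> C2 = {} \<and> (\<forall>x\<in>C1. \<forall>y\<in>C2. (x, y) \<notin> P \<and> (y, x) \<notin> P)"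

definition compatible_with :: "'i set \<Rightarrow> 'i rel \<Rightarrow> ('i set \<Rightarrow> ereal) \<Rightarrow> bool" where
  "compatible_with I P z \<longleftrightarrow>
     (\<forall>A. down_set I P A \<longrightarrow> z A < \<infinity>) \<and>
     (\<forall>A B C1 C2. down_set I P A \<longrightarrow> down_set I P B \<longrightarrow> A \<subseteq> B \<longrightarrow>
        disconnected_union P (B - A) C1 C2 \<longrightarrow> decomposes_along (minor_fun z A) C1 C2)"

text \<open>
  This is \<open>z\<^sub>C\<close> for a convex set \<open>C\<close>, obtained from an arbitrary presentation \<open>C = B - A\<close>.
  If \<open>P\<close> is compatible with \<open>z\<close>, the choice is immaterial, see \<open>convex_minor_eq\<close> below.
\<close>
definition convex_minor ::
    "'i set \<Rightarrow> 'i rel \<Rightarrow> ('i set \<Rightarrow> ereal) \<Rightarrow> 'i set \<Rightarrow> 'i set \<Rightarrow> ereal" where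
  "convex_minor I P z C =
     minor_fun z (SOME A. \<exists>B. down_set I P A \<and> down_set I P B \<and> A \<subseteq> B \<and> C = B - A)"

definition conforms_to :: "'i set \<Rightarrow> 'i rel \<Rightarrow> ('i set \<Rightarrow> ereal) \<Rightarrow> bool" where
  "conforms_to I P z \<longleftrightarrow>
     compatible_with I P z \<and>
     (\<forall>C C1 C2. convex_subset I P C \<longrightarrow> C = C1 \<union> C2 \<longrightarrow> C1 \<inter> C2 = {} \<longrightarrow>
        decomposes_along (convex_minor I P z C) C1 C2 \<longrightarrow> disconnected_union P C C1 C2)"

text \<open>This is \<open>z\<^sub>P\<close>, the product of the functions \<open>z\<^sub>C\<close> over all bubbles \<open>C\<close>.\<close>
definition bubble_product :: "'i set \<Rightarrow> 'i rel \<Rightarrow> ('i set \<Rightarrow> ereal) \<Rightarrow> 'i set \<Rightarrow> ereal" where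
  "bubble_product I P z E = (\<Sum>C\<in>bubbles I P. convex_minor I P z C (E \<inter> C))"

text \<open>This is the polyhedron \<open>\<Pi>(z)\<close>.\<close>
definition base_polyhedron :: "'i::finite set \<Rightarrow> ('i set \<Rightarrow> ereal) \<Rightarrow> (real ^ 'i) set" where
  "base_polyhedron I z =
     {x. (\<forall>i. i \<notin> I \<longrightarrow> x $ i = 0) \<and> ereal (\<Sum>i\<in>I. x $ i) = z I \<and>
         (\<forall>A\<subseteq>I. z A < \<infinity> \<longrightarrow> ereal (\<Sum>i\<in>A. x $ i) \<le> z A)}"

text \<open>This is \<open>\<Phi>\<^sub>z(P)\<close>.\<close>
definition preorder_face ::
    "'i::finite set \<Rightarrow> ('i set \<Rightarrow> ereal) \<Rightarrow> 'i rel \<Rightarrow> (real ^ 'i) set" where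
  "preorder_face I z P =
     {x \<in> base_polyhedron I z. \<forall>A. down_set I P A \<longrightarrow> ereal (\<Sum>i\<in>A. x $ i) = z A}"

lemma minor_fun_presentation_aux:
  assumes z: "\<forall>A\<subseteq>I. z A \<noteq> -\<infinity>" and comp: "compatible_with I P z"
    and A: "down_set I P A" and B: "down_set I P B" and AB: "A \<subseteq> B"
    and A': "down_set I P A'" and B': "down_set I P B'" and AB': "A' \<subseteq> B'"
    and C: "B - A = B' - A'" and U: "U \<subseteq> B - A"
  shows "minor_fun z A U = minor_fun z (A \<inter> A') U"
proof -
  define D where "D = A \<inter> A'"
  have D: "down_set I P D"
    using A A' unfolding D_def down_set_def by blast
  have "disconnected_union P (B - D) (A - D) (B - A)"
    unfolding disconnected_union_def
  proof (intro conjI ballI)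
    show "B - D = (A - D) \<union> (B - A)" "(A - D) \<inter> (B - A) = {}"
      using AB unfolding D_def by auto
    fix x y assume x: "x \<in> A - D" and y: "y \<in> B - A"
    show "(x, y) \<notin> P"
      using x y C B' unfolding D_def down_set_def by blast
    show "(y, x) \<notin> P"
      using x y A unfolding down_set_def by blast
  qed
  then have dec: "decomposes_along (minor_fun z D) (A - D) (B - A)"
    using comp D B AB unfolding compatible_with_def D_def by blast
  have 1: "((A - D) \<union> U) \<inter> (A - D) = A - D" "((A - D) \<union> U) \<inter> (B - A) = U"
    "D \<union> ((A - D) \<union> U) = A \<union> U" "D \<union> (A - D) = A"
    using U unfolding D_def by auto
  have "(A - D) \<union> U \<subseteq> (A - D) \<union> (B - A)"
    using U by blast
  then have "minor_fun z D ((A - D) \<union> U) =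
      minor_fun z D (((A - D) \<union> U) \<inter> (A - D)) + minor_fun z D (((A - D) \<union> U) \<inter> (B - A))"
    using dec unfolding decomposes_along_def by blast
  then have eq: "z (A \<union> U) - z D = (z A - z D) + (z (D \<union> U) - z D)"
    by (simp only: minor_fun_def 1)
  have sub: "A \<subseteq> I" "D \<subseteq> I" "A \<union> U \<subseteq> I" "D \<union> U \<subseteq> I"
    using A D B U unfolding down_set_def by auto
  obtain a where a: "z A = ereal a"
    using comp z A sub(1) unfolding compatible_with_def by (cases "z A") auto
  obtain d where d: "z D = ereal d"
    using comp z D sub(2) unfolding compatible_with_def by (cases "z D") auto
  have "z (A \<union> U) - z A = z (D \<union> U) - z D"
    using eq z sub(3,4) unfolding a d by (cases "z (A \<union> U)"; cases "z (D \<union> U)") auto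
  then show ?thesis
    unfolding minor_fun_def D_def .
qed

lemma minor_fun_presentation:
  assumes "\<forall>A\<subseteq>I. z A \<noteq> -\<infinity>" "compatible_with I P z"
    and "down_set I P A" "down_set I P B" "A \<subseteq> B"
    and "down_set I P A'" "down_set I P B'" "A' \<subseteq> B'"
    and "B - A = B' - A'" "U \<subseteq> B - A"
  shows "minor_fun z A U = minor_fun z A' U"
proof -
  have "minor_fun z A U = minor_fun z (A \<inter> A') U"
    by (rule minor_fun_presentation_aux[OF assms])
  also have "\<dots> = minor_fun z (A' \<inter> A) U"
    by (simp only: Int_commute)
  also have "\<dots> = minor_fun z A' U"
    using minor_fun_presentation_aux[OF assms(1,2,6-8,3-5) assms(9)[symmetric]] assms(9,10)
    by simp
  finally show ?thesis .
qed

lemma convex_minor_eq: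
  assumes "submodular_fun I z" "compatible_with I P z"
    and "down_set I P A" "down_set I P B" "A \<subseteq> B" "U \<subseteq> B - A"
  shows "convex_minor I P z (B - A) U = minor_fun z A U"
proof -
  let ?Q = "\<lambda>A'. \<exists>B'. down_set I P A' \<and> down_set I P B' \<and> A' \<subseteq> B' \<and> B - A = B' - A'"
  define A0 where "A0 = (SOME A'. ?Q A')"
  have "?Q A0"
    unfolding A0_def by (rule someI[of ?Q A]) (use assms(3-5) in blast)
  then obtain B0 where "down_set I P A0" "down_set I P B0" "A0 \<subseteq> B0" "B - A = B0 - A0"
    by blast
  then have "minor_fun z A U = minor_fun z A0 U"
    using assms unfolding submodular_fun_def
    by (intro minor_fun_presentation[of I z P A B A0 B0 U]) simp_all
  then show ?thesis
    unfolding convex_minor_def A0_def by simp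
qed

lemma bubble_convex_subset:
  assumes P: "preorder_on I P" and C: "C \<in> bubbles I P"
  shows "convex_subset I P C"
proof -
  have r: "refl_on I P" "trans P" "P \<subseteq> I \<times> I"
    using P unfolding preorder_on_def by auto
  obtain c where c: "c \<in> I" "C = (P \<inter> P\<inverse>) `` {c}"
    using C unfolding bubbles_def quotient_def by auto
  define B where "B = {x. (x, c) \<in> P}"
  define A where "A = {x. (x, c) \<in> P \<and> (c, x) \<notin> P}"
  have "down_set I P B" "down_set I P A"
    using r(3) transD[OF r(2)] unfolding down_set_def A_def B_def by blast+
  moreover have "A \<subseteq> B" "C = B - A"
    unfolding A_def B_def c(2) by auto
  ultimately show ?thesis
    unfolding convex_subset_def by blast
qed

end

theory Submission
  imports Defs
begin

text \<open>
  For a base \<open>x \<in> \<Pi>(z)\<close>, call a set \<open>A\<close> tight if \<open>x\<^sub>A = z(A)\<close>. Submodularity makes the tight sets of \<open>x\<close>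
  a lattice, and most of the argument is a study of this lattice.

  \<^emph>\<open>Non-empty face.\<close> If \<open>x \<in> \<Phi>\<^sub>z(P)\<close>, then \<open>z\<close> agrees with the modular function \<open>A \<mapsto> x\<^sub>A\<close> on
  down-sets. If \<open>B - A = C\<^sub>1 \<squnion> C\<^sub>2\<close> is a disconnected union, then \<open>A \<union> C\<^sub>1\<close> and \<open>A \<union> C\<^sub>2\<close> are down-sets,
  so that \<open>z\<close> is modular on the square formed by them, \<open>A\<close> and \<open>B\<close>. By submodularity, modularity on
  the square spreads to its interior, which is the decomposition of \<open>z\<^bsub>B/A\<^esub>\<close>
  (\<open>preorder_face_nonempty_imp_compatible\<close>).

  \<^emph>\<open>The face as a product.\<close> Let \<open>P\<close> be compatible with \<open>z\<close>. A down-set is built from the empty set by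
  adding one bubble at a time through down-sets (\<open>down_set_induct\<close>). Along such a chain, the values of
  \<open>z\<close> are the sums of the values \<open>z\<^sub>C(C)\<close>, and submodularity bounds the sum of the \<open>z\<^sub>C(E \<inter> C)\<close> by
  \<open>z(E)\<close>, so \<open>\<Pi>(z\<^sub>P) \<subseteq> \<Phi>\<^sub>z(P)\<close> (\<open>subset_preorder_face\<close>). The converse
  inclusion holds bubble by bubble (\<open>preorder_face_subset\<close>). Since \<open>z\<^sub>P\<close> is submodular and every base
  polyhedron is non-empty (\<open>base_polyhedron_nonempty\<close>), so is the face.

  \<^emph>\<open>Dimension.\<close> The sums of a point of \<open>\<Pi>(z\<^sub>P)\<close> over the bubbles are prescribed, which leaves at most
  \<open>|I| - |b(P)|\<close> dimensions. They are all attained if some base can move mass in both directions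
  between any two elements of a bubble. Take a base whose tight sets are tight at all bases
  (\<open>ex_generic_base\<close>). A move is obstructed only by a tight set \<open>A\<close> that separates the two
  elements (\<open>exchange\<close>); being tight everywhere, it makes \<open>z\<^sub>P\<close> decompose along \<open>A\<close> and
  its complement (\<open>tight_everywhere_decomposes\<close>). Hence \<open>z\<^sub>C\<close> decomposes for the bubble \<open>C\<close> of the two
  elements, and then conformity makes them incomparable, which is absurd inside a bubble.
\<close>

section \<open>Submodular functions and tight sets\<close>

abbreviation mass :: "real ^ 'i \<Rightarrow> 'i::finite set \<Rightarrow> real" where
  "mass x A \<equiv> (\<Sum>i\<in>A. x $ i)"

definition tight :: "('i::finite set \<Rightarrow> ereal) \<Rightarrow> real ^ 'i \<Rightarrow> 'i set \<Rightarrow> bool" where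
  "tight z x A \<longleftrightarrow> ereal (mass x A) = z A"

lemma submodular_funD:
  assumes "submodular_fun I z"
  shows "A \<subseteq> I \<Longrightarrow> z A \<noteq> -\<infinity>" "z {} = 0" "z I < \<infinity>"
    and "A \<subseteq> I \<Longrightarrow> B \<subseteq> I \<Longrightarrow> z (A \<union> B) + z (A \<inter> B) \<le> z A + z B"
  using assms unfolding submodular_fun_def by blast+

lemma submodular_fun_finite:
  assumes "submodular_fun I z" "A \<subseteq> I" "z A < \<infinity>"
  obtains a where "z A = ereal a"
  using submodular_funD(1)[OF assms(1,2)] assms(3) by (cases "z A") auto

text \<open>
  The sets of finite value form a lattice: finite terms on the right of the submodular inequality
  force finite terms on the left, because \<open>-\<infinity>\<close> is excluded.
\<close>
lemma submodular_fun_lattice: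
  assumes s: "submodular_fun I z" and "A \<subseteq> I" "B \<subseteq> I" "z A < \<infinity>" "z B < \<infinity>"
  shows "z (A \<union> B) < \<infinity>" "z (A \<inter> B) < \<infinity>"
proof -
  obtain a b where "z A = ereal a" "z B = ereal b"
    using submodular_fun_finite assms by metis
  then have "z (A \<union> B) + z (A \<inter> B) \<le> ereal (a + b)"
    using submodular_funD(4)[OF s assms(2,3)] by simp
  moreover have "z (A \<union> B) \<noteq> -\<infinity>" "z (A \<inter> B) \<noteq> -\<infinity>"
    using assms(2,3) by (intro submodular_funD(1)[OF s]; blast)+
  ultimately show "z (A \<union> B) < \<infinity>" "z (A \<inter> B) < \<infinity>"
    by (cases "z (A \<union> B)"; cases "z (A \<inter> B)"; simp)+
qed

lemma submodular_fun_cong: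
  assumes s: "submodular_fun I z" and eq: "\<And>A. A \<subseteq> I \<Longrightarrow> w A = z A"
  shows "submodular_fun I w"
  unfolding submodular_fun_def
proof (intro conjI allI impI)
  fix A B assume AB: "A \<subseteq> I" "B \<subseteq> I"
  then have "A \<union> B \<subseteq> I" "A \<inter> B \<subseteq> I" by auto
  then show "w (A \<union> B) + w (A \<inter> B) \<le> w A + w B"
    using submodular_funD(4)[OF s AB] AB by (simp add: eq)
qed (use submodular_funD[OF s] eq in auto)

lemma submodular_fun_restrict:
  assumes s: "submodular_fun I z" and A: "A \<subseteq> I" "z A < \<infinity>"
  shows "submodular_fun A z"
  unfolding submodular_fun_def
proof (intro conjI allI impI)
  fix B C assume "B \<subseteq> A" "C \<subseteq> A"
  then show "z (B \<union> C) + z (B \<inter> C) \<le> z B + z C"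
    using A by (intro submodular_funD(4)[OF s]) auto
qed (use submodular_funD[OF s] A in auto)

lemma submodular_fun_minor:
  assumes s: "submodular_fun I z" and A: "A \<subseteq> I" "z A < \<infinity>"
  shows "submodular_fun (I - A) (minor_fun z A)"
proof -
  obtain a where a: "z A = ereal a"
    using submodular_fun_finite[OF s A] .
  show ?thesis
    unfolding submodular_fun_def
  proof (intro conjI allI impI)
    fix B assume "B \<subseteq> I - A"
    then have "z (A \<union> B) \<noteq> -\<infinity>"
      using A by (intro submodular_funD(1)[OF s]) auto
    then show "minor_fun z A B \<noteq> -\<infinity>"
      unfolding minor_fun_def a by (cases "z (A \<union> B)") auto
  next
    show "minor_fun z A {} = 0"
      unfolding minor_fun_def by (simp add: a)
  next
    have "A \<union> (I - A) = I"
      using A by auto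
    then show "minor_fun z A (I - A) < \<infinity>"
      using submodular_funD(3)[OF s] unfolding minor_fun_def a by (cases "z I") auto
  next
    fix B C assume BC: "B \<subseteq> I - A" "C \<subseteq> I - A"
    have "z ((A \<union> B) \<union> (A \<union> C)) + z ((A \<union> B) \<inter> (A \<union> C)) \<le> z (A \<union> B) + z (A \<union> C)"
      using BC A by (intro submodular_funD(4)[OF s]) auto
    moreover have "(A \<union> B) \<union> (A \<union> C) = A \<union> (B \<union> C)" "(A \<union> B) \<inter> (A \<union> C) = A \<union> (B \<inter> C)"
      by auto
    ultimately have "z (A \<union> (B \<union> C)) + z (A \<union> (B \<inter> C)) \<le> z (A \<union> B) + z (A \<union> C)"
      by simp
    moreover have "z (A \<union> (B \<union> C)) \<noteq> -\<infinity>" "z (A \<union> (B \<inter> C)) \<noteq> -\<infinity>"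
      "z (A \<union> B) \<noteq> -\<infinity>" "z (A \<union> C) \<noteq> -\<infinity>"
      using BC A by (intro submodular_funD(1)[OF s]; blast)+
    ultimately show "minor_fun z A (B \<union> C) + minor_fun z A (B \<inter> C)
        \<le> minor_fun z A B + minor_fun z A C"
      unfolding minor_fun_def a
      by (cases "z (A \<union> (B \<union> C))"; cases "z (A \<union> (B \<inter> C))"; cases "z (A \<union> B)";
          cases "z (A \<union> C)") auto
  qed
qed

lemma base_polyhedron_iff:
  "x \<in> base_polyhedron I z \<longleftrightarrow>
     (\<forall>i. i \<notin> I \<longrightarrow> x $ i = 0) \<and> tight z x I \<and>
     (\<forall>A\<subseteq>I. z A < \<infinity> \<longrightarrow> ereal (mass x A) \<le> z A)"
  unfolding base_polyhedron_def tight_def by simp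

lemma base_polyhedron_le:
  assumes "x \<in> base_polyhedron I z" "A \<subseteq> I"
  shows "ereal (mass x A) \<le> z A"
  using assms unfolding base_polyhedron_iff by (cases "z A = \<infinity>") auto

lemma mass_Un_Int: "mass x (A \<union> B) + mass x (A \<inter> B) = mass x A + mass x B"
  by (rule sum.union_inter) auto

text \<open>
  The mass of a base is a modular lower bound of \<open>z\<close>; where it meets the submodular \<open>z\<close> at both
  \<open>A\<close> and \<open>B\<close>, there is no room left at the union or the intersection.
\<close>
lemma tight_Un_Int:
  assumes s: "submodular_fun I z" and x: "x \<in> base_polyhedron I z"
    and AB: "A \<subseteq> I" "B \<subseteq> I" and t: "tight z x A" "tight z x B"
  shows "tight z x (A \<union> B)" "tight z x (A \<inter> B)"
proof -
  have "z A < \<infinity>" "z B < \<infinity>"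
    using t[unfolded tight_def, symmetric] by simp_all
  note fin = submodular_fun_lattice[OF s AB this]
  have sub: "A \<union> B \<subseteq> I" "A \<inter> B \<subseteq> I"
    using AB by auto
  obtain u v where uv: "z (A \<union> B) = ereal u" "z (A \<inter> B) = ereal v"
    using submodular_fun_finite[OF s sub(1) fin(1)] submodular_fun_finite[OF s sub(2) fin(2)]
    by metis
  have "mass x (A \<union> B) \<le> u" "mass x (A \<inter> B) \<le> v"
    using base_polyhedron_le[OF x sub(1)] base_polyhedron_le[OF x sub(2)] uv by simp_all
  moreover have "u + v \<le> mass x A + mass x B"
    using submodular_funD(4)[OF s AB] t[unfolded tight_def, symmetric] uv by simp
  ultimately have "mass x (A \<union> B) = u" "mass x (A \<inter> B) = v"
    using mass_Un_Int[of x A B] by linarith+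
  then show "tight z x (A \<union> B)" "tight z x (A \<inter> B)"
    using uv unfolding tight_def by auto
qed

lemma tight_empty: "submodular_fun I z \<Longrightarrow> tight z x {}"
  using submodular_funD(2)[of I z] unfolding tight_def by simp

section \<open>Bases of a submodular function\<close>

text \<open>
  A base of the restriction to \<open>A\<close> and a base of the contraction by \<open>A\<close> together form a base of \<open>z\<close>:
  the two bounds for \<open>E \<inter> A\<close> and \<open>E - A\<close> add up to \<open>z(E \<inter> A) + z(E \<union> A) - z(A) \<le> z(E)\<close>. This is the
  inductive step in the construction of bases, and it makes any chosen set of finite value tight.
\<close>
lemma base_polyhedron_split:
  fixes u v :: "real ^ 'i::finite"
  assumes s: "submodular_fun I z" and A: "A \<subseteq> I" "z A < \<infinity>"
    and u: "u \<in> base_polyhedron A z" and v: "v \<in> base_polyhedron (I - A) (minor_fun z A)"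
  shows "u + v \<in> base_polyhedron I z" "tight z (u + v) A"
proof -
  obtain a where a: "z A = ereal a"
    using submodular_fun_finite[OF s A] .
  have mass: "mass (u + v) E = mass u (E \<inter> A) + mass v (E - A)" if "E \<subseteq> I" for E
  proof -
    have "mass u E = mass u (E \<inter> A)"
      using u by (intro sum.mono_neutral_right) (auto simp: base_polyhedron_iff)
    moreover have "mass v E = mass v (E - A)"
      using v by (intro sum.mono_neutral_right) (auto simp: base_polyhedron_iff)
    ultimately show ?thesis
      by (simp add: sum.distrib)
  qed
  show "tight z (u + v) A"
    using u mass[OF A(1)] unfolding base_polyhedron_iff tight_def by simp
  have uA: "mass u A = a"
    using u a unfolding base_polyhedron_iff tight_def by simp
  show "u + v \<in> base_polyhedron I z"
    unfolding base_polyhedron_iff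
  proof (intro conjI allI impI)
    show "(u + v) $ i = 0" if "i \<notin> I" for i
      using u v that A unfolding base_polyhedron_iff by auto
    have IA: "I \<inter> A = A" "A \<union> (I - A) = I"
      using A by auto
    have "ereal (mass v (I - A)) = z I - ereal a"
      using v IA unfolding base_polyhedron_iff tight_def minor_fun_def a by simp
    moreover have "ereal (mass (u + v) I) = ereal a + ereal (mass v (I - A))"
      using mass[of I] IA uA by simp
    ultimately show "tight z (u + v) I"
      unfolding tight_def by (cases "z I") auto
    fix E assume E: "E \<subseteq> I" "z E < \<infinity>"
    note fin = submodular_fun_lattice[OF s E(1) A(1) E(2) A(2)]
    have sub: "E \<union> A \<subseteq> I" "E \<inter> A \<subseteq> I"
      using A E by auto
    obtain e p q where pq: "z E = ereal e" "z (E \<union> A) = ereal p" "z (E \<inter> A) = ereal q"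
      using submodular_fun_finite[OF s sub(1) fin(1)] submodular_fun_finite[OF s sub(2) fin(2)]
        submodular_fun_finite[OF s E] by metis
    have "mass u (E \<inter> A) \<le> q"
      using base_polyhedron_le[OF u, of "E \<inter> A"] pq by simp
    moreover have "minor_fun z A (E - A) = ereal (p - a)"
      unfolding minor_fun_def a using pq by (simp add: Un_commute)
    then have "mass v (E - A) \<le> p - a"
      using base_polyhedron_le[OF v, of "E - A"] E by (simp add: Diff_mono)
    moreover have "p + q \<le> e + a"
      using submodular_funD(4)[OF s E(1) A(1)] pq a by simp
    ultimately show "ereal (mass (u + v) E) \<le> z E"
      using mass[OF E(1)] pq by simp
  qed
qed

text \<open>
  Induction on \<open>I\<close>. A proper non-empty subset of finite value splits the problem in two; if there
  is none, the only constraint is the total mass, which may sit on a single element.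
\<close>
lemma base_polyhedron_nonempty:
  fixes I :: "'i::finite set"
  assumes "submodular_fun I z"
  shows "base_polyhedron I z \<noteq> {}"
  using finite[of I] assms
proof (induction I arbitrary: z rule: finite_psubset_induct)
  case (psubset I)
  note s = psubset.prems
  show ?case
  proof (cases "\<exists>A. A \<subseteq> I \<and> A \<noteq> {} \<and> A \<noteq> I \<and> z A < \<infinity>")
    case True
    then obtain A where A: "A \<subset> I" "A \<noteq> {}" "z A < \<infinity>"
      by blast
    then have "I - A \<subset> I" "A \<subseteq> I"
      by auto
    then show ?thesis
      using psubset.IH[OF A(1) submodular_fun_restrict[OF s _ A(3)]]
        psubset.IH[OF _ submodular_fun_minor[OF s _ A(3)]]
        base_polyhedron_split(1)[OF s _ A(3)] by fast
  next
    case False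
    obtain r where r: "z I = ereal r"
      using submodular_fun_finite[OF s] submodular_funD(3)[OF s] by blast
    show ?thesis
    proof (cases "I = {}")
      case True
      then have "0 \<in> base_polyhedron I z"
        using submodular_funD(2)[OF s] by (simp add: base_polyhedron_iff tight_def)
      then show ?thesis by auto
    next
      case ne: False
      then obtain i where i: "i \<in> I" by auto
      have I: "mass (axis i r) I = r"
        using i by (simp add: axis_def)
      have "axis i r \<in> base_polyhedron I z"
        unfolding base_polyhedron_iff
      proof (intro conjI allI impI)
        show "axis i r $ j = 0" if "j \<notin> I" for j
          using that i by (auto simp: axis_def)
        show "tight z (axis i r) I"
          using I r unfolding tight_def by simp
        fix A assume "A \<subseteq> I" "z A < \<infinity>"
        then consider "A = {}" | "A = I"
          using False by blast
        then show "ereal (mass (axis i r) A) \<le> z A"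
          using I r submodular_funD(2)[OF s] by cases simp_all
      qed
      then show ?thesis by auto
    qed
  qed
qed

text \<open>Thus \<open>z\<close> can be recovered from its bases on the sets of finite value.\<close>
lemma ex_base_tight_at:
  fixes I :: "'i::finite set"
  assumes s: "submodular_fun I z" and A: "A \<subseteq> I" "z A < \<infinity>"
  obtains x where "x \<in> base_polyhedron I z" "tight z x A"
proof -
  obtain u v where "u \<in> base_polyhedron A z" "v \<in> base_polyhedron (I - A) (minor_fun z A)"
    using base_polyhedron_nonempty[OF submodular_fun_restrict[OF assms]]
      base_polyhedron_nonempty[OF submodular_fun_minor[OF assms]] by auto
  then show ?thesis
    using that base_polyhedron_split[OF assms] by metis
qed

section \<open>Generic points and exchanges\<close>

text \<open>
  An average of two lower bounds of \<open>z(A)\<close> meets \<open>z(A)\<close> only if both do, so a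
  midpoint never has a tight set that one of the two points lacks.
\<close>
lemma base_polyhedron_midpoint:
  fixes x y :: "real ^ 'i::finite"
  assumes s: "submodular_fun I z"
    and x: "x \<in> base_polyhedron I z" and y: "y \<in> base_polyhedron I z"
  defines "m \<equiv> (1 / 2) *\<^sub>R (x + y)"
  shows "m \<in> base_polyhedron I z"
    and "A \<subseteq> I \<Longrightarrow> tight z m A \<longleftrightarrow> tight z x A \<and> tight z y A"
proof -
  have mass: "mass m B = (mass x B + mass y B) / 2" for B
    unfolding m_def by (simp add: sum.distrib flip: sum_divide_distrib)
  have *: "ereal (mass m B) \<le> z B \<and> (tight z m B \<longleftrightarrow> tight z x B \<and> tight z y B)" if B: "B \<subseteq> I" for B
    using base_polyhedron_le[OF x B] base_polyhedron_le[OF y B] unfolding tight_def mass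
    by (cases "z B") (auto simp: field_simps)
  show "m \<in> base_polyhedron I z"
    unfolding base_polyhedron_iff
  proof (intro conjI allI impI)
    show "m $ i = 0" if "i \<notin> I" for i
      using x y that unfolding base_polyhedron_iff m_def by simp
    show "tight z m I"
      using * x y unfolding base_polyhedron_iff by blast
    show "ereal (mass m A) \<le> z A" if "A \<subseteq> I" for A
      using * that by blast
  qed
  show "tight z m A \<longleftrightarrow> tight z x A \<and> tight z y A" if "A \<subseteq> I"
    using * that by blast
qed

text \<open>
  A base with the least number of tight sets takes the role of a point in the relative interior:
  its midpoint with any other base has no fewer tight sets, so none is lost.
\<close>
lemma ex_generic_base:
  fixes I :: "'i::finite set"
  assumes s: "submodular_fun I z"
  obtains x where "x \<in> base_polyhedron I z"
    "\<And>A y. A \<subseteq> I \<Longrightarrow> tight z x A \<Longrightarrow> y \<in> base_polyhedron I z \<Longrightarrow> tight z y A"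
proof -
  let ?T = "\<lambda>x. {A. A \<subseteq> I \<and> tight z x A}"
  obtain x where x: "x \<in> base_polyhedron I z"
    and min: "\<And>y. y \<in> base_polyhedron I z \<Longrightarrow> card (?T x) \<le> card (?T y)"
    using ex_has_least_nat[of "\<lambda>x. x \<in> base_polyhedron I z" _ "\<lambda>x. card (?T x)"]
      base_polyhedron_nonempty[OF s] by blast
  have "tight z y A" if A: "A \<subseteq> I" "tight z x A" and y: "y \<in> base_polyhedron I z" for A y
  proof -
    note m = base_polyhedron_midpoint[OF s x y]
    have "?T ((1 / 2) *\<^sub>R (x + y)) \<subseteq> ?T x"
      using m(2) by auto
    then have "?T ((1 / 2) *\<^sub>R (x + y)) = ?T x"
      using min[OF m(1)] by (intro card_seteq) auto
    then show ?thesis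
      using m(2)[OF A(1)] A by blast
  qed
  then show ?thesis
    using that x by blast
qed

text \<open>
  Moving mass from \<open>i\<close> to \<open>j\<close> increases the mass of precisely the sets that contain \<open>j\<close> but not \<open>i\<close>.
  If none of them is tight, each of these finitely many sets leaves room for a small move.
\<close>
lemma exchange:
  fixes x :: "real ^ 'i::finite"
  assumes s: "submodular_fun I z" and x: "x \<in> base_polyhedron I z"
    and ij: "i \<in> I" "j \<in> I" "i \<noteq> j"
    and nt: "\<And>A. A \<subseteq> I \<Longrightarrow> tight z x A \<Longrightarrow> j \<in> A \<Longrightarrow> i \<in> A"
  obtains \<epsilon> where "\<epsilon> > 0" "x + \<epsilon> *\<^sub>R (axis j 1 - axis i 1) \<in> base_polyhedron I z"
proof -
  \<comment> \<open>\<open>F\<close> may be empty; the extra element \<open>1\<close> keeps the minimum meaningful and positive.\<close>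
  define F where "F = {A. A \<subseteq> I \<and> z A < \<infinity> \<and> j \<in> A \<and> i \<notin> A}"
  define slack where "slack A = real_of_ereal (z A) - mass x A" for A
  define \<epsilon> where "\<epsilon> = Min (insert 1 (slack ` F))"
  have zF: "z A = ereal (mass x A + slack A)" if "A \<in> F" for A
    using that submodular_funD(1)[OF s, of A] unfolding F_def slack_def by (cases "z A") auto
  have "slack A > 0" if "A \<in> F" for A
  proof -
    have "ereal (mass x A) \<le> z A" "\<not> tight z x A"
      using that base_polyhedron_le[OF x, of A] nt[of A] unfolding F_def by auto
    then show ?thesis
      using zF[OF that] unfolding tight_def by auto
  qed
  then have pos: "\<epsilon> > 0"
    unfolding \<epsilon>_def by (subst Min_gr_iff) auto
  have le: "\<epsilon> \<le> slack A" if "A \<in> F" for A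
    unfolding \<epsilon>_def using that by (intro Min_le) auto
  let ?y = "x + \<epsilon> *\<^sub>R (axis j 1 - axis i 1)"
  have ax: "(\<Sum>k\<in>A. axis l (1::real) $ k) = (if l \<in> A then 1 else 0)" for A and l :: 'i
    by (simp add: axis_def)
  have mass: "mass ?y A = mass x A + \<epsilon> * ((if j \<in> A then 1 else 0) - (if i \<in> A then 1 else 0))" for A
    by (simp add: sum.distrib sum_subtractf ax flip: sum_distrib_left)
  have "?y \<in> base_polyhedron I z"
    unfolding base_polyhedron_iff
  proof (intro conjI allI impI)
    show "?y $ k = 0" if "k \<notin> I" for k
      using that ij x unfolding base_polyhedron_iff by (auto simp: axis_def)
    show "tight z ?y I"
      using x ij mass[of I] unfolding base_polyhedron_iff tight_def by simp
    fix A assume A: "A \<subseteq> I" "z A < \<infinity>"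
    show "ereal (mass ?y A) \<le> z A"
    proof (cases "A \<in> F")
      case True
      then show ?thesis
        using zF[OF True] le[OF True] mass[of A] unfolding F_def by simp
    next
      case False
      then have "mass ?y A \<le> mass x A"
        using A pos mass[of A] unfolding F_def by auto
      moreover have "ereal (mass x A) \<le> z A"
        using base_polyhedron_le[OF x A(1)] .
      ultimately show ?thesis
        by (cases "z A") auto
    qed
  qed
  then show ?thesis
    using that pos by blast
qed

text \<open>
  The least tight set containing \<open>j \<in> A\<close> avoids everything outside \<open>A\<close>, by separation; \<open>A\<close> is the union
  of these sets.
\<close>
lemma tight_of_separation:
  fixes x :: "real ^ 'i::finite"
  assumes s: "submodular_fun I z" and x: "x \<in> base_polyhedron I z" and A: "A \<subseteq> I"
    and sep: "\<And>i j. i \<in> I - A \<Longrightarrow> j \<in> A \<Longrightarrow> \<exists>T\<subseteq>I. tight z x T \<and> j \<in> T \<and> i \<notin> T"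
  shows "tight z x A"
proof -
  let ?T = "\<lambda>j. {T. T \<subseteq> I \<and> tight z x T \<and> j \<in> T}"
  define D where "D j = \<Inter> (?T j)" for j
  have I: "tight z x I"
    using x unfolding base_polyhedron_iff by blast
  have Inter: "\<Inter>\<F> \<subseteq> I \<and> tight z x (\<Inter>\<F>)"
    if "finite \<F>" "\<F> \<noteq> {}" "\<F> \<subseteq> {T. T \<subseteq> I \<and> tight z x T}" for \<F>
    using that
  proof (induction rule: finite_ne_induct)
    case (insert T \<F>)
    then show ?case
      using tight_Un_Int(2)[OF s x, of T "\<Inter>\<F>"] by auto
  qed auto
  have D: "D j \<subseteq> I" "tight z x (D j)" if "j \<in> A" for j
    using Inter[of "?T j"] that A I unfolding D_def by auto
  have Union: "tight z x (\<Union>j\<in>B. D j)" if "finite B" "B \<subseteq> A" for B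
    using that
  proof (induction rule: finite_induct)
    case empty
    then show ?case using tight_empty[OF s] by simp
  next
    case (insert j B)
    then have "D j \<subseteq> I" "(\<Union>j\<in>B. D j) \<subseteq> I"
      using D by auto
    then show ?case
      using tight_Un_Int(1)[OF s x, of "D j" "\<Union>j\<in>B. D j"] insert D by auto
  qed
  have "(\<Union>j\<in>A. D j) = A"
  proof
    show "A \<subseteq> (\<Union>j\<in>A. D j)"
      unfolding D_def by auto
    show "(\<Union>j\<in>A. D j) \<subseteq> A"
    proof
      fix i assume "i \<in> (\<Union>j\<in>A. D j)"
      then obtain j where j: "j \<in> A" "i \<in> D j" by blast
      then have "i \<in> I" using D by auto
      then show "i \<in> A"
        using sep[of i j] j unfolding D_def by blast
    qed
  qed
  then show ?thesis
    using Union[of A] by simp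
qed

text \<open>
  If \<open>I - A\<close> were not tight at \<open>x\<close>, then no family of tight sets would separate it from \<open>A\<close>, so some
  mass could move from \<open>A\<close> to \<open>I - A\<close>. The result would be a base at which \<open>A\<close> is not tight.
  In particular, \<open>z(I - A)\<close> is finite.
\<close>
lemma tight_everywhere_complement:
  fixes x :: "real ^ 'i::finite"
  assumes s: "submodular_fun I z" and A: "A \<subseteq> I"
    and t: "\<And>y. y \<in> base_polyhedron I z \<Longrightarrow> tight z y A"
    and x: "x \<in> base_polyhedron I z"
  shows "tight z x (I - A)"
proof (rule tight_of_separation[OF s x])
  fix i j assume ij: "i \<in> I - (I - A)" "j \<in> I - A"
  show "\<exists>T\<subseteq>I. tight z x T \<and> j \<in> T \<and> i \<notin> T"
  proof (rule ccontr)
    assume "\<not> ?thesis"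
    then obtain \<epsilon> where \<epsilon>: "\<epsilon> > 0" "x + \<epsilon> *\<^sub>R (axis j 1 - axis i 1) \<in> base_polyhedron I z"
      using exchange[OF s x, of i j] ij by blast
    have "mass (x + \<epsilon> *\<^sub>R (axis j 1 - axis i 1)) A = mass x A"
      using t[OF \<epsilon>(2)] t[OF x] unfolding tight_def by (metis ereal.inject)
    moreover have "(\<Sum>k\<in>A. axis l (1::real) $ k) = (if l \<in> A then 1 else 0)" for l :: 'i
      by (simp add: axis_def)
    ultimately show False
      using \<epsilon>(1) ij by (simp add: sum.distrib sum_subtractf flip: sum_distrib_left)
  qed
qed auto

text \<open>
  Given \<open>E\<close> of finite value, choose a base at which \<open>E\<close> is tight. Then \<open>E \<inter> A\<close> and \<open>E - A\<close> are tight at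
  that base too, and mass is additive. If \<open>z(E) = \<infinity>\<close>, submodularity passes this value on to
  the right-hand side.
\<close>
lemma tight_everywhere_decomposes:
  fixes I :: "'i::finite set"
  assumes s: "submodular_fun I z" and A: "A \<subseteq> I"
    and t: "\<And>y. y \<in> base_polyhedron I z \<Longrightarrow> tight z y A"
  shows "decomposes_along z A (I - A)"
  unfolding decomposes_along_def
proof (intro allI impI)
  fix E assume "E \<subseteq> A \<union> (I - A)"
  then have E: "E \<subseteq> I" "E \<inter> A \<subseteq> I" "E \<inter> (I - A) \<subseteq> I"
    using A by auto
  have un: "E \<inter> A \<union> E \<inter> (I - A) = E" "(E \<inter> A) \<inter> (E \<inter> (I - A)) = {}"
    using E by auto
  show "z E = z (E \<inter> A) + z (E \<inter> (I - A))"
  proof (cases "z E < \<infinity>")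
    case True
    then obtain x where x: "x \<in> base_polyhedron I z" "tight z x E"
      using ex_base_tight_at[OF s E(1)] by blast
    have "tight z x (E \<inter> A)" "tight z x (E \<inter> (I - A))"
      using tight_Un_Int(2)[OF s x(1) E(1)] x(2) A t[OF x(1)]
        tight_everywhere_complement[OF s A t x(1)] by blast+
    moreover have "mass x E = mass x (E \<inter> A) + mass x (E \<inter> (I - A))"
      using mass_Un_Int[of x "E \<inter> A" "E \<inter> (I - A)"] un by simp
    ultimately show ?thesis
      using x(2) unfolding tight_def by (metis plus_ereal.simps(1))
  next
    case False
    have "z E \<le> z (E \<inter> A) + z (E \<inter> (I - A))"
      using submodular_funD(4)[OF s E(2,3)] un submodular_funD(2)[OF s] by simp
    then show ?thesis
      using False by auto
  qed
qed

section \<open>Dimension of a set with prescribed block sums\<close>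

text \<open>
  Drop one coordinate in each block. The directions of \<open>S\<close> have block sums zero, so the dropped
  coordinates can be recovered from the others, and no dimension is lost. The moves
  from the dropped coordinate of a block to the other ones project to multiples of unit vectors, so that
  all \<open>|I| - |I/r|\<close> remaining coordinates are free.
\<close>
lemma aff_dim_block_sums:
  fixes S :: "(real ^ 'i::finite) set"
  assumes r: "equiv I r" and x0: "x0 \<in> S"
    and supp: "\<And>x i. x \<in> S \<Longrightarrow> i \<notin> I \<Longrightarrow> x $ i = 0"
    and blocks: "\<And>x C. x \<in> S \<Longrightarrow> C \<in> I // r \<Longrightarrow> mass x C = mass x0 C"
    and moves: "\<And>i j. (i, j) \<in> r \<Longrightarrow> i \<noteq> j \<Longrightarrow>
      \<exists>\<epsilon>>0. x0 + \<epsilon> *\<^sub>R (axis j 1 - axis i 1) \<in> S"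
  shows "aff_dim S = int (card I) - int (card (I // r))"
proof -
  define rep where "rep C = (SOME c. c \<in> C)" for C :: "'i set"
  define R where "R = rep ` (I // r)"
  define J where "J = I - R"
  have rep: "rep C \<in> C" if "C \<in> I // r" for C
    using in_quotient_imp_non_empty[OF r that] unfolding rep_def by (simp add: some_in_eq)
  have "inj_on rep (I // r)"
    using quotient_disj[OF r] rep by (intro inj_onI) (metis IntI empty_iff)
  then have cardR: "card R = card (I // r)"
    unfolding R_def by (rule card_image)
  have RI: "R \<subseteq> I"
    using rep in_quotient_imp_subset[OF r] unfolding R_def by blast
  \<comment> \<open>Each block contains no representative but its own.\<close>
  have one: "i = rep C" if "C \<in> I // r" "i \<in> C" "i \<in> R" for i C
    using that quotient_disj[OF r] rep unfolding R_def by blast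
  define W where "W = {y :: real ^ 'i. (\<forall>i. i \<notin> I \<longrightarrow> y $ i = 0) \<and> (\<forall>C\<in>I // r. mass y C = 0)}"
  define proj where "proj y = (\<chi> i. if i \<in> J then y $ i else 0)" for y :: "real ^ 'i"
  have W: "subspace W"
    unfolding W_def subspace_def by (auto simp: sum.distrib simp flip: sum_distrib_left)
  have lin: "linear proj"
    unfolding proj_def by (intro linearI) (auto simp: vec_eq_iff)
  have inj: "inj_on proj W"
  proof (subst linear_injective_on_subspace_0[OF lin W], intro ballI impI)
    fix y assume y: "y \<in> W" "proj y = 0"
    have J0: "y $ i = 0" if "i \<notin> R" for i
    proof -
      have "proj y $ i = 0"
        using y by simp
      then show ?thesis
        using y that unfolding W_def proj_def J_def by (cases "i \<in> I") auto
    qed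
    have "y $ rep C = 0" if C: "C \<in> I // r" for C
    proof -
      have "mass y C = (\<Sum>i\<in>{rep C}. y $ i)"
        using rep[OF C] J0 one[OF C] by (intro sum.mono_neutral_right) auto
      then show ?thesis
        using y C unfolding W_def by auto
    qed
    then have "y $ i = 0" for i
      using J0[of i] unfolding R_def by blast
    then show "y = 0"
      by (simp add: vec_eq_iff)
  qed
  define S' where "S' = (+) (- x0) ` S"
  have S'W: "S' \<subseteq> W"
  proof
    fix y assume "y \<in> S'"
    then obtain x where x: "x \<in> S" "y = x - x0"
      unfolding S'_def by auto
    then have "y $ i = 0" if "i \<notin> I" for i
      using supp[OF x(1) that] supp[OF x0 that] by simp
    moreover have "mass y C = 0" if "C \<in> I // r" for C
      using blocks[OF x(1) that] x(2) by (simp add: sum_subtractf)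
    ultimately show "y \<in> W"
      unfolding W_def by blast
  qed
  then have "span S' \<subseteq> W"
    using W by (simp add: span_minimal)
  then have dim1: "dim (proj ` S') = dim S'"
    by (intro dim_image_eq[OF lin] inj_on_subset[OF inj])
  have axis: "axis j 1 \<in> span (proj ` S')" if j: "j \<in> J" for j
  proof -
    define C where "C = r `` {j}"
    have jI: "j \<in> I" "j \<notin> R"
      using j unfolding J_def by auto
    have C: "C \<in> I // r" "j \<in> C"
      using quotientI[OF jI(1)] equiv_class_self[OF r jI(1)] unfolding C_def by auto
    have "(rep C, j) \<in> r"
      using rep[OF C(1)] r unfolding C_def equiv_def sym_def by blast
    moreover have "rep C \<in> R"
      using C(1) unfolding R_def by blast
    moreover have ne: "rep C \<noteq> j"
      using jI calculation by auto
    ultimately obtain \<epsilon> where e: "\<epsilon> > 0" "x0 + \<epsilon> *\<^sub>R (axis j 1 - axis (rep C) 1) \<in> S"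
      using moves by blast
    have "\<epsilon> *\<^sub>R (axis j 1 - axis (rep C) 1) \<in> S'"
      using e(2) unfolding S'_def by (force simp: image_iff)
    moreover have "proj (\<epsilon> *\<^sub>R (axis j 1 - axis (rep C) 1)) = \<epsilon> *\<^sub>R axis j 1"
      using j \<open>rep C \<in> R\<close> unfolding proj_def J_def by (auto simp: vec_eq_iff axis_def)
    ultimately have "\<epsilon> *\<^sub>R axis j 1 \<in> span (proj ` S')"
      by (metis imageI span_base)
    then have "(1 / \<epsilon>) *\<^sub>R (\<epsilon> *\<^sub>R axis j 1) \<in> span (proj ` S')"
      by (rule span_scale)
    then show ?thesis
      using e(1) by simp
  qed
  have "span (proj ` S') = {y. \<forall>i. i \<notin> J \<longrightarrow> y $ i = 0}" (is "_ = ?K")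
  proof
    have "subspace ?K"
      unfolding subspace_def by auto
    then show "span (proj ` S') \<subseteq> ?K"
      by (intro span_minimal) (auto simp: proj_def)
    show "?K \<subseteq> span (proj ` S')"
    proof
      fix y assume "y \<in> ?K"
      then have "y = (\<Sum>j\<in>J. y $ j *\<^sub>R axis j 1)"
        by (auto simp: vec_eq_iff axis_def if_distrib cong: if_cong)
      also have "\<dots> \<in> span (proj ` S')"
        using axis by (intro span_sum span_scale)
      finally show "y \<in> span (proj ` S')" .
    qed
  qed
  then have "dim (proj ` S') = dim ?K"
    by (metis dim_span)
  then have "dim (proj ` S') = card J"
    by (simp add: dim_substandard_cart flip: dim_vec_eq)
  moreover have "aff_dim S = int (dim S')"
    unfolding S'_def using x0 by (intro aff_dim_eq_dim) (simp add: hull_inc)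
  moreover have "card J = card I - card R" "card R \<le> card I"
    unfolding J_def using RI by (auto simp: card_Diff_subset card_mono)
  ultimately show ?thesis
    using dim1 cardR by simp
qed

section \<open>Down-sets and bubbles\<close>

lemma bubbles_equiv: "preorder_on I P \<Longrightarrow> equiv I (P \<inter> P\<inverse>)"
  unfolding preorder_on_def
  by (intro equivI) (auto simp: refl_on_def sym_def intro: transI dest: transD)

lemma mass_bubbles:
  fixes I :: "'i::finite set"
  assumes P: "preorder_on I P" and E: "E \<subseteq> I"
  shows "mass x E = (\<Sum>C\<in>bubbles I P. mass x (E \<inter> C))"
proof -
  note r = bubbles_equiv[OF P]
  have "E = (\<Union>C\<in>bubbles I P. E \<inter> C)"
    using E Union_quotient[OF r] unfolding bubbles_def by blast
  then have "mass x E = mass x (\<Union>C\<in>bubbles I P. E \<inter> C)"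
    by simp
  also have "\<dots> = (\<Sum>C\<in>bubbles I P. mass x (E \<inter> C))"
    using quotient_disj[OF r] unfolding bubbles_def by (intro sum.UNION_disjoint) auto
  finally show ?thesis .
qed

text \<open>
  Induction along a chain of down-sets. The bubble removed from a non-empty down-set is the
  class of a maximal element, found as an element with the largest number of elements below it.
\<close>
lemma down_set_induct [consumes 2, case_names empty bubble]:
  fixes I :: "'i::finite set"
  assumes P: "preorder_on I P" and "down_set I P A"
    and empty: "Q {}"
    and bubble: "\<And>A C. C \<in> bubbles I P \<Longrightarrow> down_set I P A \<Longrightarrow> down_set I P (A \<union> C) \<Longrightarrow>
      A \<inter> C = {} \<Longrightarrow> Q A \<Longrightarrow> Q (A \<union> C)"
  shows "Q A"
  using finite[of A] assms(2)
proof (induction A rule: finite_psubset_induct)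
  case (psubset A)
  show ?case
  proof (cases "A = {}")
    case False
    have r: "refl_on I P" "trans P" "P \<subseteq> I \<times> I"
      using P unfolding preorder_on_def by auto
    have AI: "A \<subseteq> I"
      using psubset.prems unfolding down_set_def by blast
    let ?below = "\<lambda>c. card {x. (x, c) \<in> P}"
    obtain c where c: "c \<in> A" and max: "\<And>d. d \<in> A \<Longrightarrow> ?below d \<le> ?below c"
    proof -
      have fin: "finite (?below ` A)"
        by simp
      then obtain c where "c \<in> A" "?below c = Max (?below ` A)"
        using Max_in[OF fin] False by fastforce
      then show ?thesis
        using that Max_ge[OF fin] by simp
    qed
    have top: "(d, c) \<in> P" if d: "d \<in> A" "(c, d) \<in> P" for d
    proof -
      have "{x. (x, c) \<in> P} \<subseteq> {x. (x, d) \<in> P}"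
        using d transD[OF r(2)] by blast
      then have "{x. (x, c) \<in> P} = {x. (x, d) \<in> P}"
        using max[OF d(1)] by (intro card_seteq) auto
      then show ?thesis
        using r(1) d AI unfolding refl_on_def by blast
    qed
    define C where "C = (P \<inter> P\<inverse>) `` {c}"
    have C: "C \<in> bubbles I P" "c \<in> C"
      using c AI r(1) unfolding C_def bubbles_def refl_on_def by (auto intro: quotientI)
    have CA: "C \<subseteq> A"
      using psubset.prems c unfolding C_def down_set_def by blast
    have "down_set I P (A - C)"
      unfolding down_set_def
    proof (intro conjI allI impI)
      fix x y assume xy: "y \<in> A - C" "(x, y) \<in> P"
      have "x \<in> A"
        using psubset.prems xy unfolding down_set_def by blast
      moreover have "x \<notin> C"
      proof
        assume "x \<in> C"
        then have "(c, y) \<in> P"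
          using xy transD[OF r(2)] unfolding C_def by blast
        then show False
          using top[of y] xy unfolding C_def by blast
      qed
      ultimately show "x \<in> A - C" by blast
    qed (use AI in auto)
    moreover have "A - C \<subset> A" "(A - C) \<union> C = A"
      using C CA by auto
    ultimately show ?thesis
      using bubble[OF C(1), of "A - C"] psubset by auto
  qed (simp add: empty)
qed

lemma disconnected_union_sym:
  "disconnected_union P C C1 C2 \<Longrightarrow> disconnected_union P C C2 C1"
  unfolding disconnected_union_def by blast

lemma down_set_Un_part:
  assumes A: "down_set I P A" and B: "down_set I P B" and AB: "A \<subseteq> B"
    and dis: "disconnected_union P (B - A) C1 C2"
  shows "down_set I P (A \<union> C1)"
  unfolding down_set_def
proof (intro conjI allI impI)
  have C: "B - A = C1 \<union> C2"
    using dis unfolding disconnected_union_def by blast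
  then show "A \<union> C1 \<subseteq> I"
    using B AB unfolding down_set_def by blast
  fix x y assume y: "y \<in> A \<union> C1" and xy: "(x, y) \<in> P"
  show "x \<in> A \<union> C1"
  proof (cases "y \<in> A")
    case True
    then show ?thesis
      using A xy unfolding down_set_def by blast
  next
    case False
    then have "y \<in> C1" "y \<in> B"
      using y C by auto
    moreover have "x \<in> B"
      using B xy \<open>y \<in> B\<close> unfolding down_set_def by blast
    moreover have "x \<notin> C2"
      using dis xy \<open>y \<in> C1\<close> unfolding disconnected_union_def by blast
    ultimately show ?thesis
      using C by blast
  qed
qed

section \<open>The face of a preorder\<close>

text \<open>
  With \<open>E\<^sub>i = E \<inter> C\<^sub>i\<close>, one inequality is submodularity at \<open>A \<union> E\<^sub>1\<close> and \<open>A \<union> E\<^sub>2\<close>. The other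
  one is the sum of two submodular inequalities, which pass from \<open>A \<union> E\<close> by way of
  \<open>A \<union> C\<^sub>1 \<union> E\<^sub>2\<close> to \<open>B\<close>; what remains is the modularity of \<open>z\<close> on the four down-sets \<open>A\<close>, \<open>A \<union> C\<^sub>1\<close>,
  \<open>A \<union> C\<^sub>2\<close>, \<open>B\<close>, where \<open>z\<close> is the mass of \<open>x\<close>.
\<close>
lemma preorder_face_nonempty_imp_compatible:
  fixes I :: "'i::finite set"
  assumes s: "submodular_fun I z" and x: "x \<in> preorder_face I z P"
  shows "compatible_with I P z"
  unfolding compatible_with_def
proof (intro conjI allI impI)
  have zx: "z A = ereal (mass x A)" if "down_set I P A" for A
    using x that unfolding preorder_face_def by simp
  show "z A < \<infinity>" if "down_set I P A" for A
    using zx[OF that] by simp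
  fix A B C1 C2
  assume A: "down_set I P A" and B: "down_set I P B" and AB: "A \<subseteq> B"
    and dis: "disconnected_union P (B - A) C1 C2"
  have C: "B = A \<union> C1 \<union> C2" "C1 \<inter> C2 = {}" "A \<inter> C1 = {}" "A \<inter> C2 = {}"
    using AB dis unfolding disconnected_union_def by blast+
  have D1: "down_set I P (A \<union> C1)" and D2: "down_set I P (A \<union> C2)"
    using down_set_Un_part[OF A B AB dis] down_set_Un_part[OF A B AB disconnected_union_sym[OF dis]]
    by auto
  have BI: "B \<subseteq> I"
    using B unfolding down_set_def by blast
  show "decomposes_along (minor_fun z A) C1 C2"
    unfolding decomposes_along_def
  proof (intro allI impI)
    fix E assume E: "E \<subseteq> C1 \<union> C2"
    define E1 E2 where "E1 = E \<inter> C1" and "E2 = E \<inter> C2"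
    have sub: "A \<union> E \<subseteq> I" "A \<union> E1 \<subseteq> I" "A \<union> E2 \<subseteq> I" "A \<union> C1 \<subseteq> I" "A \<union> C2 \<subseteq> I"
      "A \<union> C1 \<union> E2 \<subseteq> I"
      using BI C E unfolding E1_def E2_def by auto
    have "z ((A \<union> E1) \<union> (A \<union> E2)) + z ((A \<union> E1) \<inter> (A \<union> E2)) \<le> z (A \<union> E1) + z (A \<union> E2)"
      using submodular_funD(4)[OF s sub(2,3)] .
    moreover have "(A \<union> E1) \<union> (A \<union> E2) = A \<union> E" "(A \<union> E1) \<inter> (A \<union> E2) = A"
      using C E unfolding E1_def E2_def by auto
    ultimately have up: "z (A \<union> E) + z A \<le> z (A \<union> E1) + z (A \<union> E2)"
      by simp
    have "z ((A \<union> E) \<union> (A \<union> C1)) + z ((A \<union> E) \<inter> (A \<union> C1)) \<le> z (A \<union> E) + z (A \<union> C1)"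
      using submodular_funD(4)[OF s sub(1,4)] .
    moreover have "(A \<union> E) \<union> (A \<union> C1) = A \<union> C1 \<union> E2" "(A \<union> E) \<inter> (A \<union> C1) = A \<union> E1"
      using C E unfolding E1_def E2_def by auto
    ultimately have low1: "z (A \<union> C1 \<union> E2) + z (A \<union> E1) \<le> z (A \<union> E) + z (A \<union> C1)"
      by simp
    have "z ((A \<union> C1 \<union> E2) \<union> (A \<union> C2)) + z ((A \<union> C1 \<union> E2) \<inter> (A \<union> C2))
        \<le> z (A \<union> C1 \<union> E2) + z (A \<union> C2)"
      using submodular_funD(4)[OF s sub(6,5)] .
    moreover have "(A \<union> C1 \<union> E2) \<union> (A \<union> C2) = B" "(A \<union> C1 \<union> E2) \<inter> (A \<union> C2) = A \<union> E2"
      using C E unfolding E1_def E2_def by auto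
    ultimately have low2: "z B + z (A \<union> E2) \<le> z (A \<union> C1 \<union> E2) + z (A \<union> C2)"
      by simp
    have "(A \<union> C1) \<union> (A \<union> C2) = B" "(A \<union> C1) \<inter> (A \<union> C2) = A"
      using C by auto
    then have "mass x B + mass x A = mass x (A \<union> C1) + mass x (A \<union> C2)"
      using mass_Un_Int[of x "A \<union> C1" "A \<union> C2"] by simp
    moreover have "z (A \<union> E) \<noteq> -\<infinity>" "z (A \<union> E1) \<noteq> -\<infinity>" "z (A \<union> E2) \<noteq> -\<infinity>"
      "z (A \<union> C1 \<union> E2) \<noteq> -\<infinity>"
      using sub submodular_funD(1)[OF s] by auto
    ultimately have "z (A \<union> E) - z A = (z (A \<union> E1) - z A) + (z (A \<union> E2) - z A)"
      using up low1 low2 unfolding zx[OF A] zx[OF B] zx[OF D1] zx[OF D2]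
      by (cases "z (A \<union> E)"; cases "z (A \<union> E1)"; cases "z (A \<union> E2)";
          cases "z (A \<union> C1 \<union> E2)") auto
    then show "minor_fun z A E = minor_fun z A (E \<inter> C1) + minor_fun z A (E \<inter> C2)"
      unfolding minor_fun_def E1_def E2_def .
  qed
qed

lemma submodular_fun_bubble:
  assumes s: "submodular_fun I z" and P: "preorder_on I P" and comp: "compatible_with I P z"
    and C: "C \<in> bubbles I P"
  shows "submodular_fun C (convex_minor I P z C)"
proof -
  obtain A B where AB: "down_set I P A" "down_set I P B" "A \<subseteq> B" "C = B - A"
    using bubble_convex_subset[OF P C] unfolding convex_subset_def by blast
  have "z A < \<infinity>" "z B < \<infinity>" "A \<subseteq> I" "B \<subseteq> I"
    using comp AB unfolding compatible_with_def down_set_def by blast+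
  then have "submodular_fun (B - A) (minor_fun z A)"
    using submodular_fun_minor[OF submodular_fun_restrict[OF s], of B A] AB(3) by blast
  then show ?thesis
    unfolding AB(4) using convex_minor_eq[OF s comp AB(1-3)] by (rule submodular_fun_cong)
qed

text \<open>All other factors are evaluated at the empty set.\<close>
lemma bubble_product_on_bubble:
  fixes I :: "'i::finite set"
  assumes s: "submodular_fun I z" and P: "preorder_on I P" and comp: "compatible_with I P z"
    and C: "C \<in> bubbles I P" and E: "E \<subseteq> C"
  shows "bubble_product I P z E = convex_minor I P z C E"
proof -
  have "bubble_product I P z E = (\<Sum>D\<in>{C}. convex_minor I P z D (E \<inter> D))"
    unfolding bubble_product_def
  proof (rule sum.mono_neutral_right)
    show "\<forall>D\<in>bubbles I P - {C}. convex_minor I P z D (E \<inter> D) = 0"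
    proof
      fix D assume D: "D \<in> bubbles I P - {C}"
      then have "E \<inter> D = {}"
        using quotient_disj[OF bubbles_equiv[OF P]] C E unfolding bubbles_def by blast
      then show "convex_minor I P z D (E \<inter> D) = 0"
        using submodular_funD(2)[OF submodular_fun_bubble[OF s P comp]] D by auto
    qed
  qed (use C in auto)
  then show ?thesis
    using E by (simp add: Int_absorb2)
qed

lemma sum_ereal_neq_MInfty:
  fixes f :: "'a \<Rightarrow> ereal"
  assumes "\<And>x. x \<in> S \<Longrightarrow> f x \<noteq> -\<infinity>"
  shows "(\<Sum>x\<in>S. f x) \<noteq> -\<infinity>"
  using assms by (induction S rule: infinite_finite_induct) auto

lemma submodular_fun_bubble_product:
  fixes I :: "'i::finite set"
  assumes s: "submodular_fun I z" and P: "preorder_on I P" and comp: "compatible_with I P z"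
  shows "submodular_fun I (bubble_product I P z)"
proof -
  let ?w = "convex_minor I P z"
  note sub = submodular_fun_bubble[OF s P comp]
  show ?thesis
    unfolding submodular_fun_def bubble_product_def
  proof (intro conjI allI impI)
    fix A assume "A \<subseteq> I"
    have "?w C (A \<inter> C) \<noteq> -\<infinity>" if "C \<in> bubbles I P" for C
      using submodular_funD(1)[OF sub[OF that]] by auto
    then show "(\<Sum>C\<in>bubbles I P. ?w C (A \<inter> C)) \<noteq> -\<infinity>"
      by (intro sum_ereal_neq_MInfty) auto
  next
    show "(\<Sum>C\<in>bubbles I P. ?w C ({} \<inter> C)) = 0"
      using submodular_funD(2)[OF sub] by (intro sum.neutral) auto
  next
    have "?w C (I \<inter> C) \<noteq> \<infinity>" if C: "C \<in> bubbles I P" for C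
    proof -
      have "I \<inter> C = C"
        using in_quotient_imp_subset[OF bubbles_equiv[OF P]] C unfolding bubbles_def by blast
      then show ?thesis
        using submodular_funD(3)[OF sub[OF C]] by auto
    qed
    then show "(\<Sum>C\<in>bubbles I P. ?w C (I \<inter> C)) < \<infinity>"
      by (simp add: sum_Pinfty less_top[symmetric] top_ereal_def)
  next
    fix A B
    have "?w C ((A \<union> B) \<inter> C) + ?w C ((A \<inter> B) \<inter> C) \<le> ?w C (A \<inter> C) + ?w C (B \<inter> C)"
      if C: "C \<in> bubbles I P" for C
    proof -
      have "(A \<union> B) \<inter> C = (A \<inter> C) \<union> (B \<inter> C)" "(A \<inter> B) \<inter> C = (A \<inter> C) \<inter> (B \<inter> C)"
        by auto
      then show ?thesis
        using submodular_funD(4)[OF sub[OF C], of "A \<inter> C" "B \<inter> C"] by simp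
    qed
    then show "(\<Sum>C\<in>bubbles I P. ?w C ((A \<union> B) \<inter> C)) + (\<Sum>C\<in>bubbles I P. ?w C ((A \<inter> B) \<inter> C))
        \<le> (\<Sum>C\<in>bubbles I P. ?w C (A \<inter> C)) + (\<Sum>C\<in>bubbles I P. ?w C (B \<inter> C))"
      by (simp add: sum_mono flip: sum.distrib)
  qed
qed

text \<open>
  For a bubble \<open>C = B - A\<close> and \<open>E \<subseteq> C\<close>, the mass of \<open>E\<close> is that of \<open>A \<union> E\<close> minus \<open>z(A)\<close>, hence
  at most \<open>z\<^sub>C(E)\<close>, with equality if \<open>A \<union> E\<close> is the down-set \<open>B\<close>. Then sum over all bubbles.
\<close>
lemma preorder_face_subset:
  fixes I :: "'i::finite set"
  assumes s: "submodular_fun I z" and P: "preorder_on I P" and comp: "compatible_with I P z"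
    and x: "x \<in> preorder_face I z P"
  shows "x \<in> base_polyhedron I (bubble_product I P z)"
proof -
  let ?w = "convex_minor I P z"
  have zx: "z A = ereal (mass x A)" if "down_set I P A" for A
    using x that unfolding preorder_face_def by simp
  have xz: "x \<in> base_polyhedron I z"
    using x unfolding preorder_face_def by simp
  have block: "ereal (mass x E) \<le> ?w C E \<and> (E = C \<longrightarrow> ereal (mass x E) = ?w C E)"
    if C: "C \<in> bubbles I P" and E: "E \<subseteq> C" for C E
  proof -
    obtain A B where AB: "down_set I P A" "down_set I P B" "A \<subseteq> B" "C = B - A"
      using bubble_convex_subset[OF P C] unfolding convex_subset_def by blast
    have w: "?w C E = z (A \<union> E) - ereal (mass x A)"
      using convex_minor_eq[OF s comp AB(1-3), of E] E AB(4) zx[OF AB(1)]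
      unfolding minor_fun_def by simp
    have "mass x (A \<union> E) = mass x A + mass x E"
      using AB E by (intro sum.union_disjoint) auto
    moreover have "ereal (mass x (A \<union> E)) \<le> z (A \<union> E)"
      using AB E unfolding down_set_def by (intro base_polyhedron_le[OF xz]) auto
    moreover have "z (A \<union> E) = ereal (mass x (A \<union> E))" if "E = C"
      using zx[OF AB(2)] AB that by (simp add: Un_absorb1)
    ultimately show ?thesis
      unfolding w by (cases "z (A \<union> E)") auto
  qed
  have sumE: "ereal (mass x E) = (\<Sum>C\<in>bubbles I P. ereal (mass x (E \<inter> C)))" if "E \<subseteq> I" for E
    using mass_bubbles[OF P that, of x] by simp
  have IC: "I \<inter> C = C" if "C \<in> bubbles I P" for C
    using in_quotient_imp_subset[OF bubbles_equiv[OF P]] that unfolding bubbles_def by blast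
  show ?thesis
    unfolding base_polyhedron_iff
  proof (intro conjI allI impI)
    show "x $ i = 0" if "i \<notin> I" for i
      using xz that unfolding base_polyhedron_iff by blast
    show "tight (bubble_product I P z) x I"
      unfolding tight_def bubble_product_def sumE[OF order_refl]
      using block IC by (intro sum.cong) auto
    fix E assume "E \<subseteq> I"
    then show "ereal (mass x E) \<le> bubble_product I P z E"
      unfolding bubble_product_def sumE[OF \<open>E \<subseteq> I\<close>] using block by (intro sum_mono) auto
  qed
qed

text \<open>
  The bounds \<open>x\<^sub>C \<le> z\<^sub>C(C)\<close> add up to the equality \<open>x\<^sub>I = z\<^sub>P(I)\<close> between finite values, so none is strict.
\<close>
lemma bubble_product_tight_bubble:
  fixes I :: "'i::finite set"
  assumes s: "submodular_fun I z" and P: "preorder_on I P" and comp: "compatible_with I P z"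
    and x: "x \<in> base_polyhedron I (bubble_product I P z)" and C: "C \<in> bubbles I P"
  shows "tight (bubble_product I P z) x C"
proof -
  let ?w = "bubble_product I P z"
  note sub = submodular_fun_bubble_product[OF s P comp]
  have CI: "D \<subseteq> I" if "D \<in> bubbles I P" for D
    using in_quotient_imp_subset[OF bubbles_equiv[OF P]] that unfolding bubbles_def by blast
  define f where "f D = real_of_ereal (?w D)" for D
  have f: "?w D = ereal (f D)" if D: "D \<in> bubbles I P" for D
  proof -
    have "?w D < \<infinity>"
      using submodular_funD(3)[OF submodular_fun_bubble[OF s P comp D]]
        bubble_product_on_bubble[OF s P comp D order_refl] by simp
    then show ?thesis
      using submodular_funD(1)[OF sub CI[OF D]] unfolding f_def by (cases "?w D") auto
  qed
  have "ereal (mass x I) = ?w I"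
    using x unfolding base_polyhedron_iff tight_def by blast
  also have "\<dots> = (\<Sum>D\<in>bubbles I P. ?w D)"
    unfolding bubble_product_def[of _ _ _ I]
    using bubble_product_on_bubble[OF s P comp] CI by (intro sum.cong) (auto simp: Int_absorb1)
  also have "\<dots> = ereal (\<Sum>D\<in>bubbles I P. f D)"
    using f by simp
  finally have "(\<Sum>D\<in>bubbles I P. mass x (I \<inter> D)) = (\<Sum>D\<in>bubbles I P. f D)"
    using mass_bubbles[OF P order_refl, of x] by simp
  moreover have "mass x (I \<inter> D) \<le> f D" if D: "D \<in> bubbles I P" for D
  proof -
    show ?thesis
      using base_polyhedron_le[OF x CI[OF D]] f[OF D] CI[OF D] by (simp add: Int_absorb1)
  qed
  ultimately have "mass x (I \<inter> C) = f C"
    using sum_mono_inv[of "\<lambda>D. mass x (I \<inter> D)" "bubbles I P" f C] C by auto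
  then show ?thesis
    using f[OF C] CI[OF C] unfolding tight_def by (simp add: Int_absorb1)
qed

text \<open>
  Both \<open>x\<^sub>A = z(A)\<close> for down-sets \<open>A\<close> and \<open>x\<^sub>F \<le> z(F)\<close> for \<open>F = E \<inter> A\<close> follow by adding a maximal bubble
  \<open>C\<close> to \<open>A\<close>. In the second case, the increment \<open>z\<^sub>C(E \<inter> C)\<close> is taken over all of \<open>A\<close>, and submodularity
  bounds it by the increment over the smaller set \<open>E \<inter> A\<close>.
\<close>
lemma subset_preorder_face:
  fixes I :: "'i::finite set"
  assumes s: "submodular_fun I z" and P: "preorder_on I P" and comp: "compatible_with I P z"
    and x: "x \<in> base_polyhedron I (bubble_product I P z)"
  shows "x \<in> preorder_face I z P"
proof -
  let ?w = "bubble_product I P z"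
  have w: "?w E = z (A \<union> E) - z A"
    if "C \<in> bubbles I P" "down_set I P A" "down_set I P (A \<union> C)" "A \<inter> C = {}" "E \<subseteq> C" for A C E
  proof -
    have "(A \<union> C) - A = C"
      using that by auto
    then show ?thesis
      using bubble_product_on_bubble[OF s P comp that(1,5)]
        convex_minor_eq[OF s comp that(2,3), of E] that(5)
      unfolding minor_fun_def by simp
  qed
  have zx: "z A = ereal (mass x A)" if "down_set I P A" for A
    using P that
  proof (induction rule: down_set_induct)
    case empty
    then show ?case
      using submodular_funD(2)[OF s] by simp
  next
    case (bubble A C)
    have "ereal (mass x C) = z (A \<union> C) - z A"
      using bubble_product_tight_bubble[OF s P comp x bubble.hyps(1)]
        w[OF bubble.hyps(1-4) order_refl]
      unfolding tight_def by simp
    moreover have "mass x (A \<union> C) = mass x A + mass x C"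
      using bubble.hyps(4) by (intro sum.union_disjoint) auto
    ultimately show ?case
      using bubble.IH by (cases "z (A \<union> C)") auto
  qed
  have le: "ereal (mass x (E \<inter> A)) \<le> z (E \<inter> A)" if "down_set I P A" and E: "E \<subseteq> I" "z E < \<infinity>" for A E
    using P that(1)
  proof (induction rule: down_set_induct)
    case empty
    then show ?case
      using submodular_funD(2)[OF s] by simp
  next
    case (bubble A C)
    define F where "F = E \<inter> (A \<union> C)"
    have I: "A \<subseteq> I" "A \<union> C \<subseteq> I" "F \<subseteq> I" "E \<inter> A \<subseteq> I" "A \<union> E \<inter> C \<subseteq> I"
      using bubble.hyps unfolding down_set_def F_def by auto
    have fin: "z A < \<infinity>" "z (A \<union> C) < \<infinity>"
      using zx bubble.hyps by auto
    have finF: "z F < \<infinity>"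
      unfolding F_def by (rule submodular_fun_lattice(2)[OF s E(1) I(2) E(2) fin(2)])
    have set_eq: "F \<union> A = A \<union> E \<inter> C" "F \<inter> A = E \<inter> A"
      unfolding F_def by auto
    note fin2 = submodular_fun_lattice[OF s I(3,1) finF fin(1), unfolded set_eq]
    obtain p q t where pq: "z (A \<union> E \<inter> C) = ereal p" "z (E \<inter> A) = ereal q" "z F = ereal t"
      using submodular_fun_finite[OF s I(5) fin2(1)] submodular_fun_finite[OF s I(4) fin2(2)]
        submodular_fun_finite[OF s I(3) finF] by metis
    have wE: "?w (E \<inter> C) = ereal (p - mass x A)"
      using w[OF bubble.hyps(1-4), of "E \<inter> C"] pq zx[OF bubble.hyps(2)] by simp
    then have "mass x (E \<inter> C) \<le> p - mass x A"
      using base_polyhedron_le[OF x, of "E \<inter> C"] E by (simp add: le_infI1)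
    moreover have "p + q \<le> t + mass x A"
      using submodular_funD(4)[OF s I(3,1)] pq zx[OF bubble.hyps(2)] unfolding set_eq by simp
    moreover have "mass x F = mass x (E \<inter> A) + mass x (E \<inter> C)"
      unfolding F_def Int_Un_distrib using bubble.hyps(4) by (intro sum.union_disjoint) auto
    ultimately show ?case
      using bubble.IH pq unfolding F_def by simp
  qed
  have downI: "down_set I P I"
    using P unfolding down_set_def preorder_on_def by auto
  have "x \<in> base_polyhedron I z"
    unfolding base_polyhedron_iff
  proof (intro conjI allI impI)
    show "x $ i = 0" if "i \<notin> I" for i
      using x that unfolding base_polyhedron_iff by blast
    show "tight z x I"
      using zx[OF downI] unfolding tight_def by simp
    show "ereal (mass x E) \<le> z E" if "E \<subseteq> I" "z E < \<infinity>" for E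
      using le[OF downI that] that by (simp add: Int_absorb2)
  qed
  then show ?thesis
    using zx unfolding preorder_face_def by simp
qed

text \<open>
  A generic base has no tight set that splits a bubble: such a set would be tight at all bases,
  so \<open>z\<^sub>P\<close> and, on the bubble, \<open>z\<^sub>C\<close> would decompose, against conformity. Hence
  mass can be exchanged freely inside bubbles.
\<close>
lemma aff_dim_base_polyhedron_bubble_product:
  fixes I :: "'i::finite set"
  assumes s: "submodular_fun I z" and P: "preorder_on I P" and conf: "conforms_to I P z"
  shows "aff_dim (base_polyhedron I (bubble_product I P z))
    = int (card I) - int (card (bubbles I P))"
proof -
  let ?w = "bubble_product I P z"
  have comp: "compatible_with I P z"
    using conf unfolding conforms_to_def by blast
  note sub = submodular_fun_bubble_product[OF s P comp]
  obtain x0 where x0: "x0 \<in> base_polyhedron I ?w"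
    and generic: "\<And>A y. A \<subseteq> I \<Longrightarrow> tight ?w x0 A \<Longrightarrow> y \<in> base_polyhedron I ?w \<Longrightarrow> tight ?w y A"
    using ex_generic_base[OF sub] by blast
  have closed: "i \<in> A"
    if ij: "(i, j) \<in> P \<inter> P\<inverse>" and A: "A \<subseteq> I" "tight ?w x0 A" "j \<in> A" for i j A
  proof (rule ccontr)
    assume i: "i \<notin> A"
    define C where "C = (P \<inter> P\<inverse>) `` {i}"
    have iI: "i \<in> I" and C: "C \<in> bubbles I P" "i \<in> C" "j \<in> C"
      using ij P unfolding C_def bubbles_def preorder_on_def refl_on_def
      by (auto intro!: quotientI)
    have CI: "C \<subseteq> I"
      using in_quotient_imp_subset[OF bubbles_equiv[OF P]] C unfolding bubbles_def by blast
    have dec: "decomposes_along ?w A (I - A)"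
      using tight_everywhere_decomposes[OF sub A(1)] generic[OF A(1,2)] by blast
    have "decomposes_along (convex_minor I P z C) (C \<inter> A) (C - A)"
      unfolding decomposes_along_def
    proof (intro allI impI)
      fix E assume "E \<subseteq> C \<inter> A \<union> (C - A)"
      then have E: "E \<subseteq> C" "E \<subseteq> A \<union> (I - A)"
        using CI by auto
      have eq: "E \<inter> (C \<inter> A) = E \<inter> A" "E \<inter> (C - A) = E \<inter> (I - A)"
        using E CI by auto
      have "?w E = ?w (E \<inter> A) + ?w (E \<inter> (I - A))"
        using dec E unfolding decomposes_along_def by blast
      then show "convex_minor I P z C E =
          convex_minor I P z C (E \<inter> (C \<inter> A)) + convex_minor I P z C (E \<inter> (C - A))"
        unfolding eq using bubble_product_on_bubble[OF s P comp C(1)] E(1)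
        by (metis inf.coboundedI1)
    qed
    moreover have "C = C \<inter> A \<union> (C - A)" "(C \<inter> A) \<inter> (C - A) = {}"
      by auto
    ultimately have "disconnected_union P C (C \<inter> A) (C - A)"
      using conf bubble_convex_subset[OF P C(1)] unfolding conforms_to_def by blast
    then show False
      using ij i A C unfolding disconnected_union_def by blast
  qed
  show ?thesis
    unfolding bubbles_def
  proof (rule aff_dim_block_sums[OF bubbles_equiv[OF P] x0])
    show "x $ i = 0" if "x \<in> base_polyhedron I ?w" "i \<notin> I" for x i
      using that unfolding base_polyhedron_iff by blast
    show "mass x C = mass x0 C" if "x \<in> base_polyhedron I ?w" "C \<in> I // (P \<inter> P\<inverse>)" for x C
      using bubble_product_tight_bubble[OF s P comp] that x0 unfolding tight_def bubbles_def
      by (metis ereal.inject)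
    show "\<exists>\<epsilon>>0. x0 + \<epsilon> *\<^sub>R (axis j 1 - axis i 1) \<in> base_polyhedron I ?w"
      if "(i, j) \<in> P \<inter> P\<inverse>" "i \<noteq> j" for i j
    proof -
      have "i \<in> I" "j \<in> I"
        using that P unfolding preorder_on_def by auto
      then show ?thesis
        using exchange[OF sub x0 _ _ that(2)] closed[OF that(1)] by metis
    qed
  qed
qed

theorem proposition8p3:
  fixes I :: "'i::finite set" and z :: "'i set \<Rightarrow> ereal" and P :: "'i rel"
  assumes "submodular_fun I z" and "preorder_on I P"
  shows "(preorder_face I z P \<noteq> {} \<longleftrightarrow> compatible_with I P z) \<and>
         (compatible_with I P z \<longrightarrow>
            preorder_face I z P = base_polyhedron I (bubble_product I P z)) \<and>
         (conforms_to I P z \<longrightarrow>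
            aff_dim (preorder_face I z P) = int (card I) - int (card (bubbles I P)))"
proof -
  have face: "preorder_face I z P = base_polyhedron I (bubble_product I P z)"
    if "compatible_with I P z"
  proof (intro set_eqI iffI)
    show "x \<in> base_polyhedron I (bubble_product I P z)" if "x \<in> preorder_face I z P" for x
      by (rule preorder_face_subset[OF assms \<open>compatible_with I P z\<close> that])
    show "x \<in> preorder_face I z P" if "x \<in> base_polyhedron I (bubble_product I P z)" for x
      by (rule subset_preorder_face[OF assms \<open>compatible_with I P z\<close> that])
  qed
  moreover have "preorder_face I z P \<noteq> {} \<longleftrightarrow> compatible_with I P z"
    using preorder_face_nonempty_imp_compatible[OF assms(1)] face
      base_polyhedron_nonempty[OF submodular_fun_bubble_product[OF assms]] by blast
  moreover have "compatible_with I P z" if "conforms_to I P z"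
    using that unfolding conforms_to_def by blast
  ultimately show ?thesis
    using aff_dim_base_polyhedron_bubble_product[OF assms] by simp
qed

end
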